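(* Let $\mathcal{U}=(U_\alpha)_{\alpha>0}$ be a sub-Markovian resolvent of kernels on a Lusin measurable space $(E,\mathcal{B})$ such that, for $\beta>0$, the set $\mathcal{E}(\mathcal{U}_\beta)$ of $\mathcal{U}_\beta$-excessive functions is min-stable, contains the positive constant functions and generates $\mathcal{B}$. Let $m$ be a $\sigma$-finite $\mathcal{U}$-sub-invariant measure and let $\mathcal{U}^\ast$ be the adjoint of $\mathcal{U}$ with respect to $m$. Let $1\le p<\infty$ and let $p'$ be the conjugate exponent, $\frac1p+\frac1{p'}=1$. Then the following assertions hold. (i) $\mathrm{Ker}\,\mathsf{L}_p=\mathrm{Ker}\,\mathsf{L}^\ast_p$. (ii) $\mathrm{Ker}\,\mathsf{L}_p\cap L^{p'}(E,m)\subset\mathrm{Ker}\,\mathsf{L}^\ast_{p'}$. (iii) If $u\in\mathrm{Ker}\,\mathsf{L}_p$ then $u$ is $\mathcal{U}$-invariant. (iv) If $\alpha U_\alpha1=1$ $m$-a.e. for all $\alpha>0$, or $\alpha U^\ast_\alpha1=1$ $m$-a.e. for all $\alpha>0$, then the converse of (iii) is also true for any $u\in L^p(E,m)$: if $u\in L^p(E,m)$ is $\mathcal{U}$-invariant, then $u\in\mathrm{Ker}\,\mathsf{L}_p$.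
   Context: A sub-Markovian resolvent of kernels satisfies the resolvent equation and $\alpha U_\alpha1\le1$. $p\mathcal{B}$ (resp. $bp\mathcal{B}$): positive (resp. bounded positive) $\mathcal{B}$-measurable functions. $\mathcal{U}_\beta:=(U_{\beta+\alpha})_{\alpha>0}$; a function $v\in p\mathcal{B}$ is $\mathcal{U}_\beta$-excessive if $\alpha U_{\beta+\alpha}v\le v$ for all $\alpha>0$ and $\alpha U_{\beta+\alpha}v\nearrow v$ as $\alpha\to\infty$. $m$ is sub-invariant if $m\circ\alpha U_\alpha\le m$ for all $\alpha>0$. The adjoint $\mathcal{U}^\ast=(U^\ast_\alpha)_{\alpha>0}$ is the ($m$-a.e. unique) sub-Markovian resolvent of kernels with $\int fU_\alpha g\,dm=\int gU^\ast_\alpha f\,dm$ for all $f,g\in p\mathcal{B}$, $\alpha>0$. Under these assumptions $\mathcal{U}$ and $\mathcal{U}^\ast$ are strongly continuous sub-Markovian resolvents of contractions on $L^q(E,m)$, $1\le q<\infty$. The generator $(\mathsf{L}_q,D(\mathsf{L}_q))$ associated with $\mathcal{U}$ on $L^q(E,m)$ is $D(\mathsf{L}_q)=U_\alpha(L^q(E,m))$, $\mathsf{L}_q(U_\alpha f)=\alpha U_\alpha f-f$ for $f\in L^q(E,m)$ (independent of $\alpha>0$), and $(\mathsf{L}^\ast_q,D(\mathsf{L}^\ast_q))$ is defined in the same way from $\mathcal{U}^\ast$ acting on $L^q(E,m)$. (For $q=\infty$, needed in (ii) when $p=1$, the same formula is used with $\mathcal{U}^\ast$ acting on $L^\infty(E,m)$.)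 Note that $\mathsf{L}^\ast_q$ acts on $L^q$; the adjoint operator of $\mathsf{L}_q$ is $\mathsf{L}^\ast_{q'}$. A real-valued function $v\in\bigcup_{1\le q\le\infty}L^q(E,m)$ is $\mathcal{U}$-invariant if $U_\alpha(vf)=v\,U_\alpha f$ $m$-a.e. for all $\alpha>0$ and $f\in bp\mathcal{B}$. *)

theory Defs
  imports "HOL-Analysis.Analysis"
begin

text \<open>Throughout, a measure \<open>m\<close> also carries the measurable space \<open>(E, B)\<close>, namely
  \<open>(space m, sets m)\<close>. Of \<open>m\<close>, the predicates \<open>lusin\<close>, \<open>kernel\<close>, \<open>bpB\<close>, \<open>sub_markov_resolvent\<close>
  and \<open>excessive\<close> use only this measurable space.\<close>

definition borel_alg :: "'b topology \<Rightarrow> 'b measure" where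
  "borel_alg X = sigma (topspace X) {S. openin X S}"

text \<open>A Lusin measurable space is one isomorphic to a Borel subset of a compact metrizable space.
  Such a space has at most continuum many points, so it is no restriction to take its points in the
  type \<open>real\<close>; the topology \<open>X\<close> is arbitrary and unrelated to the usual one.\<close>

definition lusin :: "'a measure \<Rightarrow> bool" where
  "lusin m \<longleftrightarrow> (\<exists>(X :: real topology) B f g.
     compact_space X \<and> metrizable_space X \<and> B \<in> sets (borel_alg X) \<and>
     f \<in> measurable m (restrict_space (borel_alg X) B) \<and>
     g \<in> measurable (restrict_space (borel_alg X) B) m \<and>
     (\<forall>x\<in>space m. g (f x) = x) \<and> (\<forall>y\<in>B. f (g y) = y))"

definition kernel :: "'a measure \<Rightarrow> ('a \<Rightarrow> 'a measure) \<Rightarrow> bool" where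
  "kernel m K \<longleftrightarrow> (\<forall>x\<in>space m. sets (K x) = sets m) \<and>
     (\<forall>A\<in>sets m. (\<lambda>x. emeasure (K x) A) \<in> borel_measurable m)"

text \<open>Action of a kernel on positive, possibly infinite, functions and on real functions. If
  \<open>K = U\<^sub>\<alpha>\<close> for a resolvent with sub-invariant measure \<open>m\<close> and \<open>f \<in> L\<^sup>q(E, m)\<close>, then \<open>f\<close> is
  \<open>K x\<close>-integrable for \<open>m\<close>-almost every \<open>x\<close>; at the other points \<open>kapp K f x = 0\<close>.\<close>

definition kapp_nn :: "('a \<Rightarrow> 'a measure) \<Rightarrow> ('a \<Rightarrow> ennreal) \<Rightarrow> 'a \<Rightarrow> ennreal" where
  "kapp_nn K f x = (\<integral>\<^sup>+y. f y \<partial>K x)"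

definition kapp :: "('a \<Rightarrow> 'a measure) \<Rightarrow> ('a \<Rightarrow> real) \<Rightarrow> 'a \<Rightarrow> real" where
  "kapp K f x = (\<integral>y. f y \<partial>K x)"

definition bpB :: "'a measure \<Rightarrow> ('a \<Rightarrow> real) set" where
  "bpB m = {f \<in> borel_measurable m. bounded (f ` space m) \<and> (\<forall>x\<in>space m. 0 \<le> f x)}"

definition sub_markov_resolvent :: "'a measure \<Rightarrow> (real \<Rightarrow> 'a \<Rightarrow> 'a measure) \<Rightarrow> bool" where
  "sub_markov_resolvent m U \<longleftrightarrow>
     (\<forall>\<alpha>>0. kernel m (U \<alpha>)) \<and>
     (\<forall>\<alpha>>0. \<forall>x\<in>space m. ennreal \<alpha> * kapp_nn (U \<alpha>) (\<lambda>_. 1) x \<le> 1) \<and>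
     (\<forall>\<alpha>>0. \<forall>\<beta>>0. \<forall>f\<in>bpB m. \<forall>x\<in>space m.
        kapp (U \<alpha>) f x - kapp (U \<beta>) f x = (\<beta> - \<alpha>) * kapp (U \<alpha>) (kapp (U \<beta>) f) x)"

definition excessive ::
    "'a measure \<Rightarrow> (real \<Rightarrow> 'a \<Rightarrow> 'a measure) \<Rightarrow> real \<Rightarrow> ('a \<Rightarrow> ennreal) set" where
  "excessive m U \<beta> = {v \<in> borel_measurable m. \<forall>x\<in>space m.
     (\<forall>\<alpha>>0. ennreal \<alpha> * kapp_nn (U (\<beta> + \<alpha>)) v x \<le> v x) \<and>
     mono_on {0<..} (\<lambda>\<alpha>. ennreal \<alpha> * kapp_nn (U (\<beta> + \<alpha>)) v x) \<and>
     ((\<lambda>\<alpha>. ennreal \<alpha> * kapp_nn (U (\<beta> + \<alpha>)) v x) \<longlongrightarrow> v x) at_top}"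

definition min_stable :: "('a \<Rightarrow> ennreal) set \<Rightarrow> bool" where
  "min_stable F \<longleftrightarrow> (\<forall>u\<in>F. \<forall>v\<in>F. (\<lambda>x. min (u x) (v x)) \<in> F)"

definition generates :: "'a measure \<Rightarrow> ('a \<Rightarrow> ennreal) set \<Rightarrow> bool" where
  "generates m F \<longleftrightarrow>
     sigma_sets (space m) {v -` A \<inter> space m | v A. v \<in> F \<and> A \<in> sets borel} = sets m"

definition sub_invariant :: "'a measure \<Rightarrow> (real \<Rightarrow> 'a \<Rightarrow> 'a measure) \<Rightarrow> bool" where
  "sub_invariant m U \<longleftrightarrow>
     (\<forall>\<alpha>>0. \<forall>A\<in>sets m. (\<integral>\<^sup>+x. ennreal \<alpha> * emeasure (U \<alpha> x) A \<partial>m) \<le> emeasure m A)"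

definition adjoint_resolvent ::
    "'a measure \<Rightarrow> (real \<Rightarrow> 'a \<Rightarrow> 'a measure) \<Rightarrow> (real \<Rightarrow> 'a \<Rightarrow> 'a measure) \<Rightarrow> bool" where
  "adjoint_resolvent m U U' \<longleftrightarrow> sub_markov_resolvent m U' \<and>
     (\<forall>\<alpha>>0. \<forall>f\<in>borel_measurable m. \<forall>g\<in>borel_measurable m.
        (\<integral>\<^sup>+x. f x * kapp_nn (U \<alpha>) g x \<partial>m) = (\<integral>\<^sup>+x. g x * kapp_nn (U' \<alpha>) f x \<partial>m))"

text \<open>Elements of \<open>L\<^sup>q\<close> are functions, not classes; equality in \<open>L\<^sup>q\<close> is written out as \<open>AE\<close>.\<close>

definition Lspace :: "'a measure \<Rightarrow> ennreal \<Rightarrow> ('a \<Rightarrow> real) set" where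
  "Lspace m q = {f \<in> borel_measurable m.
     if q = \<infinity> then (\<exists>C. AE x in m. \<bar>f x\<bar> \<le> C)
     else integrable m (\<lambda>x. \<bar>f x\<bar> powr enn2real q)}"

text \<open>The generator on \<open>L\<^sup>q\<close> as its graph, closed under \<open>m\<close>-a.e. equality in both components: all
  pairs \<open>(U\<^sub>\<alpha> f, \<alpha> U\<^sub>\<alpha> f - f)\<close> with \<open>f \<in> L\<^sup>q\<close>. By the resolvent equation the pairs obtained from a
  single \<open>\<alpha> > 0\<close> already form the whole graph.\<close>

definition generator ::
    "'a measure \<Rightarrow> (real \<Rightarrow> 'a \<Rightarrow> 'a measure) \<Rightarrow> ennreal \<Rightarrow> (('a \<Rightarrow> real) \<times> ('a \<Rightarrow> real)) set" where
  "generator m U q = {(u, w). u \<in> Lspace m q \<and> w \<in> Lspace m q \<and>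
     (\<exists>\<alpha>>0. \<exists>f\<in>Lspace m q. (AE x in m. u x = kapp (U \<alpha>) f x) \<and>
        (AE x in m. w x = \<alpha> * kapp (U \<alpha>) f x - f x))}"

definition gen_ker ::
    "'a measure \<Rightarrow> (real \<Rightarrow> 'a \<Rightarrow> 'a measure) \<Rightarrow> ennreal \<Rightarrow> ('a \<Rightarrow> real) set" where
  "gen_ker m U q = {u. (u, \<lambda>_. 0) \<in> generator m U q}"

definition resolvent_invariant ::
    "'a measure \<Rightarrow> (real \<Rightarrow> 'a \<Rightarrow> 'a measure) \<Rightarrow> ('a \<Rightarrow> real) \<Rightarrow> bool" where
  "resolvent_invariant m U v \<longleftrightarrow> (\<exists>q\<ge>1. v \<in> Lspace m q) \<and>
     (\<forall>\<alpha>>0. \<forall>f\<in>bpB m. AE x in m. kapp (U \<alpha>) (\<lambda>y. v y * f y) x = v x * kapp (U \<alpha>) f x)"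

end

theory Submission imports Defs begin

text \<open>Let \<open>u \<in> L\<^sup>p\<close> satisfy \<open>u = \<alpha>U\<^sub>\<alpha>u\<close>. For \<open>c > 0\<close> the function \<open>(u - c)\<^sup>+\<close> is \<open>m\<close>-integrable and, as
  \<open>\<alpha>U\<^sub>\<alpha>1 \<le> 1\<close>, dominated by \<open>\<alpha>U\<^sub>\<alpha>(u - c)\<^sup>+\<close>, so sub-invariance of \<open>m\<close> forces equality. Letting \<open>c\<close> run
  through the positive rationals, for \<open>u\<close> and for \<open>-u\<close>, shows that for almost every \<open>x\<close> the measure
  \<open>U\<^sub>\<alpha>(x, \<cdot>)\<close> is carried by the level set \<open>{u = u(x)}\<close> and that \<open>\<alpha>U\<^sub>\<alpha>1(x) = 1\<close> if \<open>u(x) \<noteq> 0\<close>.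
  By the resolvent equation this holds for every \<open>\<alpha>\<close> if it holds for one, which gives (iii).
  Both properties pass to \<open>U\<^sup>*\<^sub>\<alpha>\<close> by duality, the second one because the sets \<open>{|u| > 1/n}\<close> have finite
  measure; this is (i), and (ii) follows. Conversely, testing invariance against the indicators of
  \<open>{u \<le> c}\<close> and \<open>{u \<ge> c}\<close> recovers the level set property, and conservativeness of either resolvent
  gives \<open>\<alpha>U\<^sub>\<alpha>1 = 1\<close> on \<open>{u \<noteq> 0}\<close>.\<close>

section \<open>Kernels in duality, at a fixed parameter\<close>

text \<open>The hypotheses are symmetric in \<open>K\<close> and \<open>K'\<close>, so each result
  for one kernel of the resolvent is also available for its adjoint. Sub-invariance of m comes from
  \<open>duality\<close> together with \<open>mass_le'\<close>.\<close>

locale adjoint_kernels =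
  fixes m :: "'a measure" and K K' :: "'a \<Rightarrow> 'a measure" and \<alpha> :: real
  assumes \<alpha>_pos: "0 < \<alpha>"
    and kernel: "kernel m K" and kernel': "kernel m K'"
    and mass_le: "x \<in> space m \<Longrightarrow> ennreal \<alpha> * kapp_nn K (\<lambda>_. 1) x \<le> 1"
    and mass_le': "x \<in> space m \<Longrightarrow> ennreal \<alpha> * kapp_nn K' (\<lambda>_. 1) x \<le> 1"
    and duality: "f \<in> borel_measurable m \<Longrightarrow> g \<in> borel_measurable m \<Longrightarrow>
      (\<integral>\<^sup>+x. f x * kapp_nn K g x \<partial>m) = (\<integral>\<^sup>+x. g x * kapp_nn K' f x \<partial>m)"

lemma adjoint_kernels_swap:
  assumes "adjoint_kernels m K K' \<alpha>"
  shows "adjoint_kernels m K' K \<alpha>"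
proof -
  interpret adjoint_kernels m K K' \<alpha> by fact
  show ?thesis
    by unfold_locales ((fact \<alpha>_pos kernel kernel' mass_le mass_le') | rule duality[symmetric], assumption+)+
qed

lemma sets_kernel: "kernel m K \<Longrightarrow> x \<in> space m \<Longrightarrow> sets (K x) = sets m"
  by (simp add: kernel_def)

lemma space_kernel: "kernel m K \<Longrightarrow> x \<in> space m \<Longrightarrow> space (K x) = space m"
  by (meson sets_kernel sets_eq_imp_space_eq)

lemma measurable_kernel:
  "kernel m K \<Longrightarrow> x \<in> space m \<Longrightarrow> f \<in> borel_measurable m \<Longrightarrow> f \<in> borel_measurable (K x)"
  by (subst measurable_cong_sets[OF sets_kernel refl])

lemma kapp_nn_measurable:
  assumes "kernel m K" and "f \<in> borel_measurable m"
  shows "kapp_nn K f \<in> borel_measurable m"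
  using assms(2)
proof (induction rule: borel_measurable_induct)
  case (cong f g)
  have "kapp_nn K f x = kapp_nn K g x" if "x \<in> space m" for x
    unfolding kapp_nn_def by (rule nn_integral_cong) (simp add: cong space_kernel[OF assms(1) that])
  then show ?case using cong by (simp cong: measurable_cong)
next
  case (set A)
  have "kapp_nn K (indicator A) x = emeasure (K x) A" if "x \<in> space m" for x
    unfolding kapp_nn_def using set sets_kernel[OF assms(1) that] by simp
  then show ?case using assms(1) set by (simp add: kernel_def cong: measurable_cong)
next
  case (mult u c)
  have "kapp_nn K (\<lambda>y. c * u y) x = c * kapp_nn K u x" if "x \<in> space m" for x
    unfolding kapp_nn_def by (intro nn_integral_cmult measurable_kernel[OF assms(1) that] mult)
  then show ?case using mult by (simp cong: measurable_cong)
next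
  case (add u v)
  have "kapp_nn K (\<lambda>y. v y + u y) x = kapp_nn K v x + kapp_nn K u x" if "x \<in> space m" for x
    unfolding kapp_nn_def by (intro nn_integral_add measurable_kernel[OF assms(1) that] add)
  then show ?case using add by (simp cong: measurable_cong)
next
  case (seq F)
  have "kapp_nn K (\<lambda>y. SUP i. F i y) x = (SUP i. kapp_nn K (F i) x)" if "x \<in> space m" for x
    unfolding kapp_nn_def
    by (intro nn_integral_monotone_convergence_SUP measurable_kernel[OF assms(1) that] seq)
  then show ?case using seq by (simp add: image_comp cong: measurable_cong)
qed

section \<open>Positive parts and functions in \<open>Lspace\<close>\<close>

text \<open>\<open>ennreal\<close> sends negative reals to 0, so \<open>ennreal (u x - c)\<close>
  encodes the positive part of u - c. The explicit maximum is for places where that function is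
  integrated as a real one.\<close>

lemma ennreal_max_0_eq: "ennreal (max 0 t) = ennreal t"
  by (simp add: ennreal_neg max_def)

lemma Lspace_measurable: "u \<in> Lspace m q \<Longrightarrow> u \<in> borel_measurable m"
  by (simp add: Lspace_def)

lemma Lspace_cmult: assumes "u \<in> Lspace m q" shows "(\<lambda>x. c * u x) \<in> Lspace m q"
proof (cases "q = \<infinity>")
  case True
  then obtain C where "AE x in m. \<bar>u x\<bar> \<le> C" using assms by (auto simp: Lspace_def)
  then have "AE x in m. \<bar>c * u x\<bar> \<le> \<bar>c\<bar> * C"
    by eventually_elim (simp add: abs_mult mult_left_mono)
  then show ?thesis using True assms by (auto simp: Lspace_def)
next
  case False
  then show ?thesis using assms by (auto simp: Lspace_def abs_mult powr_mult)
qed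

lemma Lspace_zero: "(\<lambda>_. 0) \<in> Lspace m q"
  by (auto simp: Lspace_def)

lemma Lspace_uminus: "u \<in> Lspace m q \<Longrightarrow> (\<lambda>x. - u x) \<in> Lspace m q"
  using Lspace_cmult[of u m q "-1"] by simp

lemma enn2real_ge_1: "1 \<le> p \<Longrightarrow> p < \<infinity> \<Longrightarrow> 1 \<le> enn2real p"
  using enn2real_mono[of 1 p] by simp

lemma Lspace_powr_finite:
  assumes "u \<in> Lspace m p" "p < \<infinity>"
  shows "(\<integral>\<^sup>+x. ennreal (\<bar>u x\<bar> powr enn2real p) \<partial>m) < \<infinity>"
  using assms by (cases "p = \<infinity>") (auto simp: Lspace_def integrable_iff_bounded)

text \<open>Where u > c, write u = u^(1-r) u^r; as 1 - r \<le> 0, the first factor is at most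
  c^(1-r). At c = 0 this fails: the positive part of u need not be integrable.\<close>

lemma Lspace_excess_finite:
  assumes u: "u \<in> Lspace m p" and p: "1 \<le> p" "p < \<infinity>" and c: "0 < c"
  shows "(\<integral>\<^sup>+x. ennreal (u x - c) \<partial>m) < \<infinity>"
proof -
  define r where "r = enn2real p"
  have r: "1 \<le> r" using enn2real_ge_1[OF p] by (simp add: r_def)
  have [measurable]: "u \<in> borel_measurable m" using Lspace_measurable[OF u] .
  have "u x - c \<le> c powr (1 - r) * \<bar>u x\<bar> powr r" for x
  proof (cases "u x \<le> c")
    case True
    then have "u x - c \<le> 0" by simp
    also have "0 \<le> c powr (1 - r) * \<bar>u x\<bar> powr r" by simp
    finally show ?thesis .
  next
    case False
    then have "\<bar>u x\<bar> powr (1 - r) \<le> c powr (1 - r)"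
      using c r by (intro powr_mono2') auto
    then have "\<bar>u x\<bar> powr (1 - r) * \<bar>u x\<bar> powr r \<le> c powr (1 - r) * \<bar>u x\<bar> powr r"
      by (rule mult_right_mono) simp
    moreover have "\<bar>u x\<bar> powr (1 - r) * \<bar>u x\<bar> powr r = \<bar>u x\<bar>"
      using False c by (simp flip: powr_add)
    ultimately show ?thesis using c by linarith
  qed
  then have "(\<integral>\<^sup>+x. ennreal (u x - c) \<partial>m) \<le>
      (\<integral>\<^sup>+x. ennreal (c powr (1 - r)) * ennreal (\<bar>u x\<bar> powr r) \<partial>m)"
    by (intro nn_integral_mono) (simp flip: ennreal_mult add: ennreal_leI)
  also have "\<dots> = ennreal (c powr (1 - r)) * (\<integral>\<^sup>+x. ennreal (\<bar>u x\<bar> powr r) \<partial>m)"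
    by (rule nn_integral_cmult) measurable
  also have "\<dots> < \<infinity>"
    using Lspace_powr_finite[OF u p(2)] by (simp add: r_def ennreal_mult_less_top)
  finally show ?thesis .
qed

section \<open>Consequences of sub-invariance\<close>

context adjoint_kernels
begin

text \<open>Duality against the constant \<alpha> moves the action onto that constant, where
  \<open>mass_le'\<close> gives the bound 1.\<close>

lemma subinvariant:
  assumes f: "f \<in> borel_measurable m"
  shows "(\<integral>\<^sup>+x. ennreal \<alpha> * kapp_nn K f x \<partial>m) \<le> (\<integral>\<^sup>+x. f x \<partial>m)"
proof -
  have "(\<integral>\<^sup>+x. ennreal \<alpha> * kapp_nn K f x \<partial>m) = (\<integral>\<^sup>+x. f x * kapp_nn K' (\<lambda>_. ennreal \<alpha>) x \<partial>m)"
    using duality[of "\<lambda>_. ennreal \<alpha>" f] f by simp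
  also have "\<dots> \<le> (\<integral>\<^sup>+x. f x * 1 \<partial>m)"
  proof (intro nn_integral_mono mult_left_mono)
    fix x assume "x \<in> space m"
    then show "kapp_nn K' (\<lambda>_. ennreal \<alpha>) x \<le> 1" using mass_le'[of x]
      by (simp add: kapp_nn_def)
  qed simp
  finally show ?thesis by simp
qed

lemma finite_measure_kernel: "x \<in> space m \<Longrightarrow> finite_measure (K x)"
proof
  assume x: "x \<in> space m"
  show "emeasure (K x) (space (K x)) \<noteq> \<infinity>"
    using mass_le[OF x] \<alpha>_pos
    by (auto simp: kapp_nn_def ennreal_mult_eq_top_iff top_unique)
qed

lemma measure_le: "x \<in> space m \<Longrightarrow> \<alpha> * measure (K x) (space (K x)) \<le> 1"
  using mass_le[of x] finite_measure_kernel[of x] \<alpha>_pos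
  by (simp add: kapp_nn_def finite_measure.emeasure_eq_measure flip: ennreal_mult)

lemma kapp_const: "kapp K (\<lambda>_. c) x = c * measure (K x) (space (K x))"
  by (simp add: kapp_def)

lemma AE_kapp_nn_finite:
  assumes f: "f \<in> borel_measurable m" and fin: "(\<integral>\<^sup>+x. f x \<partial>m) < \<infinity>"
  shows "AE x in m. kapp_nn K f x < \<infinity>"
proof -
  have [measurable]: "kapp_nn K f \<in> borel_measurable m" using kapp_nn_measurable[OF kernel f] .
  have "(\<integral>\<^sup>+x. ennreal \<alpha> * kapp_nn K f x \<partial>m) \<noteq> \<infinity>"
    using subinvariant[OF f] fin by auto
  then have "AE x in m. ennreal \<alpha> * kapp_nn K f x \<noteq> \<infinity>"
    by (intro nn_integral_noteq_infinite) auto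
  then show ?thesis
    by eventually_elim (use \<alpha>_pos in \<open>auto simp: ennreal_mult_eq_top_iff top.not_eq_extremum\<close>)
qed

text \<open>By sub-invariance an m-null set is \<open>K x\<close>-null for almost every x. Hence
  identities that hold m-a.e. may be used under the kernel.\<close>

lemma AE_kernel:
  assumes "AE x in m. P x"
  shows "AE x in m. AE y in K x. P y"
proof -
  obtain N where N: "{x \<in> space m. \<not> P x} \<subseteq> N" "N \<in> sets m" "emeasure m N = 0"
    using assms by (auto elim: AE_E)
  have [measurable]: "kapp_nn K (indicator N) \<in> borel_measurable m"
    using kapp_nn_measurable[OF kernel] N(2) by simp
  have "(\<integral>\<^sup>+x. ennreal \<alpha> * kapp_nn K (indicator N) x \<partial>m) = 0"
    using subinvariant[of "indicator N"] N by simp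
  then have "AE x in m. ennreal \<alpha> * kapp_nn K (indicator N) x = 0"
    by (subst (asm) nn_integral_0_iff_AE) auto
  then show ?thesis using AE_space
  proof eventually_elim
    case (elim x)
    have "emeasure (K x) N = 0"
      using elim N(2) \<alpha>_pos sets_kernel[OF kernel, of x] by (simp add: kapp_nn_def)
    then show ?case using N elim(2)
      by (intro AE_I[of _ _ N]) (auto simp: sets_kernel[OF kernel] space_kernel[OF kernel])
  qed
qed

text \<open>Sub-invariance makes |u|^r integrable under \<open>K x\<close> for almost every x; since
  \<open>K x\<close> is finite, |t| \<le> 1 + |t|^r carries this over to u.\<close>

lemma AE_integrable_kernel:
  assumes u: "u \<in> Lspace m p" and p: "1 \<le> p" "p < \<infinity>"
  shows "AE x in m. integrable (K x) u"
proof -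
  define r where "r = enn2real p"
  have r: "1 \<le> r" using enn2real_ge_1[OF p] by (simp add: r_def)
  have um [measurable]: "u \<in> borel_measurable m" using Lspace_measurable[OF u] .
  have "AE x in m. kapp_nn K (\<lambda>x. ennreal (\<bar>u x\<bar> powr r)) x < \<infinity>"
    by (rule AE_kapp_nn_finite) (use Lspace_powr_finite[OF u p(2)] in \<open>auto simp: r_def\<close>)
  then show ?thesis using AE_space
  proof eventually_elim
    case (elim x)
    interpret finite_measure "K x" using elim by (simp add: finite_measure_kernel)
    have um: "u \<in> borel_measurable (K x)" using um measurable_kernel[OF kernel elim(2)] by blast
    have i: "integrable (K x) (\<lambda>y. \<bar>u y\<bar> powr r)"
      using elim(1) um by (simp add: kapp_nn_def integrable_iff_bounded)
    show ?case
    proof (rule Bochner_Integration.integrable_bound[OF _ um])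
      show "integrable (K x) (\<lambda>y. 1 + \<bar>u y\<bar> powr r)" using i by simp
      have "\<bar>t\<bar> \<le> 1 + \<bar>t\<bar> powr r" for t :: real
      proof (cases "\<bar>t\<bar> \<le> 1")
        case False
        then have "\<bar>t\<bar> powr 1 \<le> \<bar>t\<bar> powr r" using r by (intro powr_mono) auto
        then show ?thesis using False by simp
      qed (simp add: add_increasing2)
      then show "AE y in K x. norm (u y) \<le> norm (1 + \<bar>u y\<bar> powr r)"
        by (auto intro!: AE_I2)
    qed
  qed
qed

section \<open>Fixed functions and level sets\<close>

text \<open>The difference of the two sides of \<open>le\<close> is nonnegative, and sub-invariance
  forces its integral to be 0; the finite integral of f permits the subtraction.\<close>

lemma AE_kernel_fixed_if_le:
  assumes f: "f \<in> borel_measurable m" and fin: "(\<integral>\<^sup>+x. f x \<partial>m) < \<infinity>"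
    and le: "AE x in m. f x \<le> ennreal \<alpha> * kapp_nn K f x"
  shows "AE x in m. ennreal \<alpha> * kapp_nn K f x = f x"
proof -
  have [measurable]: "kapp_nn K f \<in> borel_measurable m" using kapp_nn_measurable[OF kernel f] .
  have "(\<integral>\<^sup>+x. ennreal \<alpha> * kapp_nn K f x - f x \<partial>m)
      = (\<integral>\<^sup>+x. ennreal \<alpha> * kapp_nn K f x \<partial>m) - (\<integral>\<^sup>+x. f x \<partial>m)"
    using f fin le by (intro nn_integral_diff) auto
  also have "\<dots> = 0" 
    using subinvariant[OF f] le_less_trans[OF subinvariant[OF f] fin]
    by (intro diff_eq_0_ennreal) auto
  finally have "AE x in m. ennreal \<alpha> * kapp_nn K f x - f x = 0"
    using f by (subst (asm) nn_integral_0_iff_AE) auto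
  \<comment> \<open>Truncated subtraction yields one inequality only; \<open>le\<close> supplies the
    other.\<close>
  then show ?thesis using le
  proof eventually_elim
    case (elim x)
    then show ?case by (metis antisym ennreal_minus_eq_0 diff_eq_0_iff_ennreal)
  qed
qed

text \<open>For rational c > u(x) the positive part of u - c vanishes at x; being fixed by
  \<alpha>K, it has integral 0 under \<open>K x\<close>, so u \<le> c there. Then c decreases to
  u(x). Only positive levels are available, whence the restriction to u(x) \<ge> 0.\<close>

lemma AE_kernel_le_if_fixed:
  assumes u: "u \<in> Lspace m p" and p: "1 \<le> p" "p < \<infinity>"
    and fixed: "AE x in m. u x = \<alpha> * kapp K u x"
  shows "AE x in m. 0 \<le> u x \<longrightarrow> (AE y in K x. u y \<le> u x)"
proof -
  have um [measurable]: "u \<in> borel_measurable m" using Lspace_measurable[OF u] .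
  have "AE x in m. ennreal \<alpha> * kapp_nn K (\<lambda>x. ennreal (u x - c)) x = ennreal (u x - c)"
    if c: "0 < c" for c
  proof (rule AE_kernel_fixed_if_le)
    show "(\<integral>\<^sup>+x. ennreal (u x - c) \<partial>m) < \<infinity>" by (rule Lspace_excess_finite[OF u p c])
    show "AE x in m. ennreal (u x - c) \<le> ennreal \<alpha> * kapp_nn K (\<lambda>x. ennreal (u x - c)) x"
      using fixed AE_integrable_kernel[OF u p] AE_space
    proof eventually_elim
      case (elim x)
      interpret finite_measure "K x" using elim by (simp add: finite_measure_kernel)
      have i: "integrable (K x) (\<lambda>y. max 0 (u y - c))" using elim by auto
      \<comment> \<open>As c > 0 and \<alpha>K1 \<le> 1, subtracting c\<alpha>K1(x) from u(x)
        instead of c can only give more, and the result is \<alpha>K(u - c)(x).\<close>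
      have "c * (\<alpha> * measure (K x) (space (K x))) \<le> c * 1"
        using measure_le[OF elim(3)] c by (intro mult_left_mono) auto
      then have "u x - c \<le> \<alpha> * (\<integral>y. u y \<partial>K x) - \<alpha> * (c * measure (K x) (space (K x)))"
        using elim(1) by (simp add: kapp_def mult.left_commute)
      also have "\<dots> = \<alpha> * (\<integral>y. u y - c \<partial>K x)"
        using elim(2) by (simp add: Bochner_Integration.integral_diff algebra_simps)
      also have "\<dots> \<le> \<alpha> * (\<integral>y. max 0 (u y - c) \<partial>K x)"
        using elim(2) i \<alpha>_pos by (intro mult_left_mono integral_mono) auto
      finally have "ennreal (u x - c) \<le> ennreal (\<alpha> * (\<integral>y. max 0 (u y - c) \<partial>K x))"
        by (rule ennreal_leI)
      also have "\<dots> = ennreal \<alpha> * (\<integral>\<^sup>+y. ennreal (max 0 (u y - c)) \<partial>K x)"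
        using \<alpha>_pos i by (subst nn_integral_eq_integral) (auto simp: ennreal_mult)
      finally show ?case by (simp add: kapp_nn_def ennreal_max_0_eq)
    qed
  qed measurable
  then have "AE x in m. \<forall>c\<in>\<rat> \<inter> {0<..}.
      ennreal \<alpha> * kapp_nn K (\<lambda>x. ennreal (u x - c)) x = ennreal (u x - c)"
    by (subst AE_ball_countable) (auto simp: countable_rat)
  then show ?thesis using AE_space
  proof eventually_elim
    case (elim x)
    have um: "u \<in> borel_measurable (K x)" using um measurable_kernel[OF kernel elim(2)] by blast
    show ?case
    proof
      assume ux: "0 \<le> u x"
      have "AE y in K x. \<forall>c\<in>\<rat> \<inter> {u x<..}. u y \<le> c"
      proof (subst AE_ball_countable; clarsimp simp: countable_rat)
        fix c assume c: "c \<in> \<rat>" "u x < c"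
        then have "ennreal \<alpha> * kapp_nn K (\<lambda>x. ennreal (u x - c)) x = 0"
          using bspec[OF elim(1), of c] ux by (simp add: ennreal_neg)
        then have "(\<integral>\<^sup>+y. ennreal (u y - c) \<partial>K x) = 0"
          using \<alpha>_pos by (simp add: kapp_nn_def)
        then have "AE y in K x. ennreal (u y - c) = 0"
          using um by (subst (asm) nn_integral_0_iff_AE) auto
        then show "AE y in K x. u y \<le> c" by eventually_elim (simp add: ennreal_eq_0_iff)
      qed
      then show "AE y in K x. u y \<le> u x"
      proof eventually_elim
        case (elim y)
        show ?case
        proof (rule ccontr)
          assume "\<not> u y \<le> u x"
          then obtain c where c: "c \<in> \<rat>" "u x < c" "c < u y"
            using Rats_dense_in_real[of "u x" "u y"] by auto
          then show False using bspec[OF elim, of c] by simp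
        qed
      qed
    qed
  qed
qed

text \<open>Where u(x) > 0, the upper bound on u is attained in mean, which leaves no room for
  smaller values or missing mass; where u(x) < 0, the same applies to -u. Where u(x) = 0, the bounds
  for u and -u give equality but say nothing about the mass, hence the guard.\<close>

lemma AE_kernel_eq_if_fixed:
  assumes u: "u \<in> Lspace m p" and p: "1 \<le> p" "p < \<infinity>"
    and fixed: "AE x in m. u x = \<alpha> * kapp K u x"
  shows "AE x in m. (AE y in K x. u y = u x) \<and> (u x \<noteq> 0 \<longrightarrow> \<alpha> * kapp K (\<lambda>_. 1) x = 1)"
proof -
  have fixed': "AE x in m. - u x = \<alpha> * kapp K (\<lambda>x. - u x) x"
    using fixed by eventually_elim (simp add: kapp_def)
  have pinned: "(AE y in K x. v y = v x) \<and> \<alpha> * kapp K (\<lambda>_. 1) x = 1"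
    if x: "x \<in> space m" and i: "integrable (K x) v" and v: "v x = \<alpha> * kapp K v x" "0 < v x"
      and le: "AE y in K x. v y \<le> v x" for x v
  proof -
    interpret finite_measure "K x" using x by (rule finite_measure_kernel)
    \<comment> \<open>The left side is nonnegative because v \<le> v(x) a.e., the right side
      nonpositive because v(x) > 0 and \<alpha>K1(x) \<le> 1, so both vanish.\<close>
    have eq: "\<alpha> * (\<integral>y. v x - v y \<partial>K x) = v x * (\<alpha> * measure (K x) (space (K x)) - 1)"
      using i v(1) by (simp add: Bochner_Integration.integral_diff kapp_def algebra_simps)
    moreover have "\<dots> \<le> 0"
      using measure_le[OF x] v(2) by (simp add: mult_nonneg_nonpos)
    ultimately have "(\<integral>y. v x - v y \<partial>K x) \<le> 0"
      using \<alpha>_pos by (metis mult_le_0_iff not_le)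
    moreover have "0 \<le> (\<integral>y. v x - v y \<partial>K x)"
      using le by (intro integral_nonneg_AE) auto
    ultimately have 0: "(\<integral>y. v x - v y \<partial>K x) = 0" by simp
    then have "AE y in K x. v x - v y = 0"
      using i le by (subst (asm) integral_nonneg_eq_0_iff_AE) auto
    moreover have "\<alpha> * measure (K x) (space (K x)) = 1" using eq 0 v(2) by simp
    ultimately show ?thesis by (auto simp: kapp_const)
  qed
  show ?thesis
    using AE_kernel_le_if_fixed[OF u p fixed] AE_kernel_le_if_fixed[OF Lspace_uminus[OF u] p fixed']
      AE_integrable_kernel[OF u p] fixed fixed' AE_space
  proof eventually_elim
    case (elim x)
    consider "u x > 0" | "u x = 0" | "u x < 0" by linarith
    then show ?case
    proof cases
      case 1
      then show ?thesis using pinned[of x u] elim by simp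
    next
      case 2
      then have "AE y in K x. u y \<le> 0" "AE y in K x. - u y \<le> 0" using elim by auto
      then have "AE y in K x. u y = u x" by eventually_elim (simp add: 2)
      then show ?thesis using 2 by simp
    next
      case 3
      then show ?thesis using pinned[of x "\<lambda>x. - u x"] elim by simp
    qed
  qed
qed

section \<open>Passing to the adjoint kernel\<close>

text \<open>Under \<open>K\<close> no mass goes from {u \<le> c} to {u > c}, so by duality none goes
  from {u > c} to {u \<le> c} under \<open>K'\<close>; likewise with the sets exchanged. Rational c
  separate any two values of u.\<close>

lemma AE_adjoint_kernel_eq:
  assumes u [measurable]: "u \<in> borel_measurable m" and eq: "AE x in m. AE y in K x. u y = u x"
  shows "AE x in m. AE y in K' x. u y = (u x :: real)"
proof -
  \<comment> \<open>The integral of K(x, B) over A equals that of K'(x, A) over B; if it is 0, the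
    nonnegative integrand K'(x, A) vanishes a.e. on B.\<close>
  have transfer: "AE x in m. x \<in> B \<longrightarrow> (AE y in K' x. y \<notin> A)"
    if [measurable]: "A \<in> sets m" "B \<in> sets m"
      and *: "AE x in m. x \<in> A \<longrightarrow> (AE y in K x. y \<notin> B)" for A B
  proof -
    have [measurable]: "kapp_nn K' (indicator A) \<in> borel_measurable m"
      using kapp_nn_measurable[OF kernel'] that by simp
    have "(\<integral>\<^sup>+x. indicator B x * kapp_nn K' (indicator A) x \<partial>m)
        = (\<integral>\<^sup>+x. indicator A x * kapp_nn K (indicator B) x \<partial>m)"
      by (rule duality[symmetric]) measurable
    also have "\<dots> = (\<integral>\<^sup>+x. 0 \<partial>m)"
    proof (rule nn_integral_cong_AE)
      show "AE x in m. indicator A x * kapp_nn K (indicator B) x = 0"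
        using * AE_space
      proof eventually_elim
        case (elim x)
        have "kapp_nn K (indicator B) x = 0" if "x \<in> A"
        proof -
          have "AE y in K x. y \<notin> B" using elim that by simp
          then show ?thesis unfolding kapp_nn_def
            by (subst nn_integral_cong_AE[where v = "\<lambda>_. 0"]) (auto elim: eventually_mono)
        qed
        then show ?case by (cases "x \<in> A") auto
      qed
    qed
    finally have "AE x in m. indicator B x * kapp_nn K' (indicator A) x = 0"
      by (simp add: nn_integral_0_iff_AE)
    then show ?thesis using AE_space
    proof eventually_elim
      case (elim x)
      have A: "A \<in> sets (K' x)" using that sets_kernel[OF kernel' elim(2)] by simp
      show ?case
      proof
        assume "x \<in> B"
        then have "emeasure (K' x) A = 0" using elim A by (simp add: kapp_nn_def)
        then show "AE y in K' x. y \<notin> A" using A by (intro AE_not_in) auto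
      qed
    qed
  qed
  have *: "AE x in m. \<forall>c\<in>\<rat>. (c < u x \<longrightarrow> (AE y in K' x. c < u y)) \<and>
      (u x \<le> c \<longrightarrow> (AE y in K' x. u y \<le> c))"
  proof (subst AE_ball_countable, simp add: countable_rat, intro ballI)
    fix c :: real
    have "AE x in m. x \<in> {x \<in> space m. c < u x} \<longrightarrow> (AE y in K' x. y \<notin> {x \<in> space m. u x \<le> c})"
      using eq by (intro transfer) (measurable, auto elim!: eventually_mono)
    moreover have "AE x in m. x \<in> {x \<in> space m. u x \<le> c} \<longrightarrow> (AE y in K' x. y \<notin> {x \<in> space m. c < u x})"
      using eq by (intro transfer) (measurable, auto elim!: eventually_mono)
    ultimately show "AE x in m. (c < u x \<longrightarrow> (AE y in K' x. c < u y)) \<and>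
      (u x \<le> c \<longrightarrow> (AE y in K' x. u y \<le> c))"
      using AE_space
    proof eventually_elim
      case (elim x)
      have "AE y in K' x. y \<in> space m"
        using AE_space[of "K' x"] space_kernel[OF kernel' elim(3)] by simp
      then show ?case using elim by (auto elim: eventually_elim2)
    qed
  qed
  then show ?thesis
  proof eventually_elim
    case (elim x)
    have "AE y in K' x. \<forall>c\<in>\<rat>. (c < u x \<longrightarrow> c < u y) \<and> (u x \<le> c \<longrightarrow> u y \<le> c)"
      using elim by (subst AE_ball_countable) (auto simp: countable_rat)
    then show ?case
    proof eventually_elim
      case (elim y)
      show ?case
        using Rats_dense_in_real[of "u x" "u y"] Rats_dense_in_real[of "u y" "u x"] elim
        by (meson less_le_not_le linorder_less_linear order_less_imp_le leD)
    qed
  qed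
qed

lemma mass_eq:
  "x \<in> space m \<Longrightarrow> ennreal \<alpha> * kapp_nn K (\<lambda>_. 1) x = ennreal (\<alpha> * kapp K (\<lambda>_. 1) x)"
  using finite_measure_kernel[of x] \<alpha>_pos
  by (simp add: kapp_const kapp_nn_def finite_measure.emeasure_eq_measure ennreal_mult)

lemma AE_kernel_mult:
  assumes u: "u \<in> borel_measurable m" and f: "f \<in> borel_measurable m"
    and eq: "AE x in m. AE y in K x. u y = u x"
  shows "AE x in m. kapp K (\<lambda>y. u y * f y) x = u x * kapp K f x"
  using eq AE_space
proof eventually_elim
  case (elim x)
  have [measurable]: "u \<in> borel_measurable (K x)" "f \<in> borel_measurable (K x)"
    using measurable_kernel[OF kernel elim(2)] u f by blast+
  have "(\<integral>y. u y * f y \<partial>K x) = (\<integral>y. u x * f y \<partial>K x)"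
    using elim(1) by (intro integral_cong_AE) auto
  \<comment> \<open>The constant u(x) comes out of the integral in all cases: if f is not
    \<open>K x\<close>-integrable, both sides are 0 by convention.\<close>
  then show ?case by (simp add: kapp_def)
qed

lemma AE_kernel_fixed_if_eq:
  assumes "u \<in> borel_measurable m" "AE x in m. AE y in K x. u y = u x"
    and one: "AE x in m. u x \<noteq> 0 \<longrightarrow> \<alpha> * kapp K (\<lambda>_. 1) x = 1"
  shows "AE x in m. u x = \<alpha> * kapp K u x"
proof -
  have "AE x in m. kapp K u x = u x * kapp K (\<lambda>_. 1) x"
    using AE_kernel_mult[OF assms(1) _ assms(2), of "\<lambda>_. 1"] by simp
  then show ?thesis using one by eventually_elim auto
qed

text \<open>Under \<open>K x\<close> the composite is the constant h(u(x)), which \<alpha>K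
  multiplies by the mass \<alpha>K1(x). That mass is 1 where u(x) \<noteq> 0, and h(0) = 0 covers
  the other points. The uses are h an indicator and h = \<open>ennreal\<close>, the positive
  part.\<close>

lemma AE_kernel_comp_fixed:
  assumes eq: "AE x in m. AE y in K x. u y = u x"
    and one: "AE x in m. u x \<noteq> 0 \<longrightarrow> \<alpha> * kapp K (\<lambda>_. 1) x = 1"
    and h: "h 0 = 0"
  shows "AE x in m. ennreal \<alpha> * kapp_nn K (\<lambda>y. h (u y)) x = h (u x)"
  using eq one AE_space
proof eventually_elim
  case (elim x)
  have "(\<integral>\<^sup>+y. h (u y) \<partial>K x) = (\<integral>\<^sup>+y. h (u x) \<partial>K x)"
    using elim(1) by (intro nn_integral_cong_AE) (auto elim: eventually_mono)
  then have "ennreal \<alpha> * kapp_nn K (\<lambda>y. h (u y)) x = h (u x) * (ennreal \<alpha> * kapp_nn K (\<lambda>_. 1) x)"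
    by (simp add: kapp_nn_def mult_ac)
  then show ?case using elim h by (cases "u x = 0") (auto simp: mass_eq)
qed

text \<open>The set A = {|u| > 1/(n+1)} has finite measure, and its indicator is a function of u
  vanishing at 0, hence fixed by \<alpha>K. By duality \<alpha>K'1 has integral m(A) over A; as
  \<alpha>K'1 \<le> 1, it equals 1 a.e. on A. These sets exhaust {u \<noteq> 0}.\<close>

lemma AE_adjoint_mass_one:
  assumes u: "u \<in> Lspace m p" and p: "1 \<le> p" "p < \<infinity>"
    and eq: "AE x in m. AE y in K x. u y = u x"
    and one: "AE x in m. u x \<noteq> 0 \<longrightarrow> \<alpha> * kapp K (\<lambda>_. 1) x = 1"
  shows "AE x in m. u x \<noteq> 0 \<longrightarrow> \<alpha> * kapp K' (\<lambda>_. 1) x = 1"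
proof -
  interpret dual: adjoint_kernels m K' K \<alpha>
    by (rule adjoint_kernels_swap) (rule adjoint_kernels_axioms)
  define r where "r = enn2real p"
  have r: "1 \<le> r" using enn2real_ge_1[OF p] by (simp add: r_def)
  have [measurable]: "u \<in> borel_measurable m" using Lspace_measurable[OF u] .
  have [measurable]: "kapp_nn K' (\<lambda>_. 1) \<in> borel_measurable m"
    using kapp_nn_measurable[OF kernel'] by simp
  have "AE x in m. 1 / real (Suc n) < \<bar>u x\<bar> \<longrightarrow> \<alpha> * kapp K' (\<lambda>_. 1) x = 1" for n
  proof -
    define h :: "real \<Rightarrow> ennreal" where "h = indicator {t. 1 / real (Suc n) < \<bar>t\<bar>}"
    have [measurable]: "h \<in> borel_measurable borel" unfolding h_def by measurable
    \<comment> \<open>Chebyshev: if |t| > 1/(n+1), then ((n+1)|t|)^r \<ge> 1.\<close>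
    have hle: "h t \<le> ennreal (real (Suc n) powr r) * ennreal (\<bar>t\<bar> powr r)" for t
    proof (cases "1 / real (Suc n) < \<bar>t\<bar>")
      case True
      then have "1 \<le> (real (Suc n) * \<bar>t\<bar>) powr r"
        using r by (intro ge_one_powr_ge_zero) (auto simp: field_simps)
      then have "ennreal 1 \<le> ennreal (real (Suc n) powr r * \<bar>t\<bar> powr r)"
        by (intro ennreal_leI) (simp add: powr_mult)
      then show ?thesis using True by (simp add: h_def ennreal_mult)
    qed (simp add: h_def)
    have "(\<integral>\<^sup>+x. h (u x) \<partial>m) \<le> (\<integral>\<^sup>+x. ennreal (real (Suc n) powr r) * ennreal (\<bar>u x\<bar> powr r) \<partial>m)"
      by (intro nn_integral_mono hle)
    also have "\<dots> = ennreal (real (Suc n) powr r) * (\<integral>\<^sup>+x. ennreal (\<bar>u x\<bar> powr r) \<partial>m)"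
      by (rule nn_integral_cmult) measurable
    also have "\<dots> < \<infinity>"
      using Lspace_powr_finite[OF u p(2)] by (simp add: r_def ennreal_mult_less_top)
    finally have fin: "(\<integral>\<^sup>+x. h (u x) \<partial>m) < \<infinity>" .
    define k where "k x = ennreal \<alpha> * kapp_nn K' (\<lambda>_. 1) x" for x
    have [measurable]: "k \<in> borel_measurable m" unfolding k_def by measurable
    have le: "h (u x) * k x \<le> h (u x)" if "x \<in> space m" for x
      using mult_left_mono[OF mass_le'[OF that], of "h (u x)"] by (simp add: k_def)
    have "(\<integral>\<^sup>+x. h (u x) * k x \<partial>m) = (\<integral>\<^sup>+x. (ennreal \<alpha> * h (u x)) * kapp_nn K' (\<lambda>_. 1) x \<partial>m)"
      by (simp add: k_def mult_ac)
    also have "\<dots> = (\<integral>\<^sup>+x. 1 * kapp_nn K (\<lambda>y. ennreal \<alpha> * h (u y)) x \<partial>m)"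
      by (rule dual.duality) measurable
    also have "\<dots> = (\<integral>\<^sup>+x. ennreal \<alpha> * kapp_nn K (\<lambda>y. h (u y)) x \<partial>m)"
    proof (rule nn_integral_cong)
      fix x assume x: "x \<in> space m"
      show "1 * kapp_nn K (\<lambda>y. ennreal \<alpha> * h (u y)) x = ennreal \<alpha> * kapp_nn K (\<lambda>y. h (u y)) x"
        unfolding kapp_nn_def mult_1_left
        by (intro nn_integral_cmult measurable_kernel[OF kernel x]) measurable
    qed
    also have "\<dots> = (\<integral>\<^sup>+x. h (u x) \<partial>m)"
      using AE_kernel_comp_fixed[OF eq one, of h] by (intro nn_integral_cong_AE) (auto simp: h_def)
    finally have int_eq: "(\<integral>\<^sup>+x. h (u x) * k x \<partial>m) = (\<integral>\<^sup>+x. h (u x) \<partial>m)" .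
    have "(\<integral>\<^sup>+x. h (u x) - h (u x) * k x \<partial>m) = (\<integral>\<^sup>+x. h (u x) \<partial>m) - (\<integral>\<^sup>+x. h (u x) * k x \<partial>m)"
      using fin le int_eq by (intro nn_integral_diff AE_I2) auto
    also have "\<dots> = 0" using int_eq fin by simp
    finally have "AE x in m. h (u x) - h (u x) * k x = 0"
      by (subst (asm) nn_integral_0_iff_AE) auto
    then show ?thesis using AE_space
    proof eventually_elim
      case (elim x)
      show ?case
      proof
        assume "1 / real (Suc n) < \<bar>u x\<bar>"
        then have "h (u x) = 1" by (simp add: h_def)
        then have "1 \<le> k x" using elim(1) by (simp add: diff_eq_0_iff_ennreal)
        then have "k x = 1" using mass_le'[OF elim(2)] by (intro antisym) (simp_all add: k_def)
        then show "\<alpha> * kapp K' (\<lambda>_. 1) x = 1"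
          using dual.mass_eq[OF elim(2)] by (simp add: k_def)
      qed
    qed
  qed
  then have "AE x in m. \<forall>n. 1 / real (Suc n) < \<bar>u x\<bar> \<longrightarrow> \<alpha> * kapp K' (\<lambda>_. 1) x = 1"
    unfolding AE_all_countable by blast
  then show ?thesis
  proof eventually_elim
    case (elim x)
    show ?case
    proof
      assume "u x \<noteq> 0"
      then obtain n where "inverse (real (Suc n)) < \<bar>u x\<bar>" using reals_Archimedean[of "\<bar>u x\<bar>"] by auto
      then show "\<alpha> * kapp K' (\<lambda>_. 1) x = 1" using elim by (metis inverse_eq_divide)
    qed
  qed
qed

text \<open>The level set property and the unit mass both pass to \<open>K'\<close>, and together
  they restore the fixed-point equation.\<close>

lemma AE_adjoint_kernel_fixed:
  assumes u: "u \<in> Lspace m p" and p: "1 \<le> p" "p < \<infinity>"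
    and fixed: "AE x in m. u x = \<alpha> * kapp K u x"
  shows "AE x in m. u x = \<alpha> * kapp K' u x"
proof -
  interpret dual: adjoint_kernels m K' K \<alpha>
    by (rule adjoint_kernels_swap) (rule adjoint_kernels_axioms)
  have eq: "AE x in m. AE y in K x. u y = u x"
    and one: "AE x in m. u x \<noteq> 0 \<longrightarrow> \<alpha> * kapp K (\<lambda>_. 1) x = 1"
    using AE_kernel_eq_if_fixed[OF u p fixed] by auto
  have um: "u \<in> borel_measurable m" using Lspace_measurable[OF u] .
  show ?thesis
    by (rule dual.AE_kernel_fixed_if_eq[OF um AE_adjoint_kernel_eq[OF um eq]
          AE_adjoint_mass_one[OF u p eq one]])
qed

section \<open>From invariance to level sets\<close>

text \<open>With f the indicator of A, invariance says that u - u(x) has integral 0 over A under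
  \<open>K x\<close>. On A = {u \<le> c} with c < u(x) the integrand is strictly negative, so A is
  null; {u \<ge> c} with c > u(x) is symmetric. With c rational, one exceptional null set serves all
  levels.\<close>

lemma AE_kernel_eq_if_invariant:
  assumes u: "u \<in> Lspace m p" and p: "1 \<le> p" "p < \<infinity>"
    and inv: "\<And>f. f \<in> bpB m \<Longrightarrow> AE x in m. kapp K (\<lambda>y. u y * f y) x = u x * kapp K f x"
  shows "AE x in m. AE y in K x. u y = u x"
proof -
  have um [measurable]: "u \<in> borel_measurable m" using Lspace_measurable[OF u] .
  have bp: "indicator A \<in> bpB m" if "A \<in> sets m" for A
    using that by (auto simp: bpB_def bounded_iff indicator_def intro!: exI[of _ 1])
  define Q where "Q A x \<longleftrightarrow> kapp K (\<lambda>y. u y * indicator A y) x = u x * kapp K (indicator A) x" for A x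
  have "AE x in m. \<forall>c\<in>\<rat>. Q {x \<in> space m. u x \<le> c} x \<and> Q {x \<in> space m. c \<le> u x} x"
    unfolding Q_def
    by (subst AE_ball_countable, rule countable_rat, intro ballI AE_conjI inv bp) measurable
  then show ?thesis using AE_integrable_kernel[OF u p] AE_space
  proof eventually_elim
    case (elim x)
    interpret finite_measure "K x" using elim by (simp add: finite_measure_kernel)
    have sets: "A \<in> sets m \<Longrightarrow> A \<in> sets (K x)" for A
      using sets_kernel[OF kernel elim(3)] by simp
    have 0: "(\<integral>y. (u y - u x) * indicator A y \<partial>K x) = 0"
      if A: "A \<in> sets m" and "Q A x" for A
    proof -
      have "integrable (K x) (\<lambda>y. u y * indicator A y)"
        using elim(2) sets[OF A] integrable_real_mult_indicator by blast
      moreover have "integrable (K x) (\<lambda>y. u x * indicator A y)"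
        using sets[OF A] by (intro integrable_mult_right) (simp add: less_top[symmetric])
      ultimately show ?thesis using that(2)
        by (simp add: Q_def kapp_def left_diff_distrib)
    qed
    have int: "integrable (K x) (\<lambda>y. (u y - u x) * indicator A y)" if "A \<in> sets m" for A
      using elim(2) sets[OF that] by (intro integrable_real_mult_indicator) auto
    have "AE y in K x. \<forall>c\<in>\<rat>. (c < u x \<longrightarrow> \<not> u y \<le> c) \<and> (u x < c \<longrightarrow> \<not> c \<le> u y)"
    proof (subst AE_ball_countable, simp add: countable_rat, intro ballI)
      fix c :: real assume c: "c \<in> \<rat>"
      let ?A = "{x \<in> space m. u x \<le> c}" and ?B = "{x \<in> space m. c \<le> u x}"
      have space: "AE y in K x. y \<in> space m"
        using AE_space[of "K x"] space_kernel[OF kernel elim(3)] by simp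
      \<comment> \<open>The sign is reversed for \<open>?A\<close> so that the integrand is
        nonnegative when c < u(x).\<close>
      have A: "(\<integral>y. (u x - u y) * indicator ?A y \<partial>K x) = 0" and B: "(\<integral>y. (u y - u x) * indicator ?B y \<partial>K x) = 0"
        using 0[of ?A] 0[of ?B] elim(1) c
        by (auto simp: minus_diff_eq[of "u _" "u x", symmetric] simp del: minus_diff_eq)
      have "AE y in K x. \<not> u y \<le> c" if "c < u x"
      proof -
        have "integrable (K x) (\<lambda>y. - ((u y - u x) * indicator ?A y))" using int[of ?A] by auto
        then have "integrable (K x) (\<lambda>y. (u x - u y) * indicator ?A y)"
          by (rule back_subst[of "integrable (K x)"]) (auto simp: algebra_simps)
        then have "AE y in K x. (u x - u y) * indicator ?A y = 0"
          using A that by (subst (asm) integral_nonneg_eq_0_iff_AE) (auto simp: indicator_def)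
        then show ?thesis using space by eventually_elim (use that in \<open>auto simp: indicator_def split: if_splits\<close>)
      qed
      moreover have "AE y in K x. \<not> c \<le> u y" if "u x < c"
      proof -
        have "AE y in K x. (u y - u x) * indicator ?B y = 0"
          using B that int[of ?B] by (subst (asm) integral_nonneg_eq_0_iff_AE) (auto simp: indicator_def)
        then show ?thesis using space by eventually_elim (use that in \<open>auto simp: indicator_def split: if_splits\<close>)
      qed
      ultimately show "AE y in K x. (c < u x \<longrightarrow> \<not> u y \<le> c) \<and> (u x < c \<longrightarrow> \<not> c \<le> u y)"
        by (cases "c < u x"; cases "u x < c") auto
    qed
    then show ?case
    proof eventually_elim
      case (elim y)
      show ?case
        using Rats_dense_in_real[of "u x" "u y"] Rats_dense_in_real[of "u y" "u x"] elim
        by (meson linorder_less_linear order_less_imp_le)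
    qed
  qed
qed

end

section \<open>Independence of the resolvent parameter\<close>

text \<open>\<open>sub_markov_resolvent\<close> provides the equation for bounded functions;
  truncation at n and monotone limits extend it to unbounded f. Sums replace differences because the
  terms may be infinite.\<close>

lemma resolvent_equation_nn:
  assumes U: "sub_markov_resolvent m U" and pos: "0 < \<alpha>" "0 < \<beta>"
    and f [measurable]: "f \<in> borel_measurable m" and nn: "\<And>x. 0 \<le> (f x :: real)" and x: "x \<in> space m"
  shows "kapp_nn (U \<beta>) f x + ennreal \<beta> * kapp_nn (U \<beta>) (kapp_nn (U \<alpha>) f) x =
    kapp_nn (U \<alpha>) f x + ennreal \<alpha> * kapp_nn (U \<beta>) (kapp_nn (U \<alpha>) f) x"
proof -
  have k: "kernel m (U \<gamma>)" if "0 < \<gamma>" for \<gamma> using U that by (simp add: sub_markov_resolvent_def)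
  have fin: "finite_measure (U \<gamma> y)" if "0 < \<gamma>" "y \<in> space m" for \<gamma> y
  proof
    have "ennreal \<gamma> * kapp_nn (U \<gamma>) (\<lambda>_. 1) y \<le> 1"
      using U that by (simp add: sub_markov_resolvent_def)
    then show "emeasure (U \<gamma> y) (space (U \<gamma> y)) \<noteq> \<infinity>"
      using that by (auto simp: kapp_nn_def ennreal_mult_eq_top_iff top_unique)
  qed
  \<comment> \<open>This links the two actions: they agree on bounded nonnegative functions since
    \<open>U \<gamma> y\<close> is finite.\<close>
  have bounded_kapp: "kapp_nn (U \<gamma>) g y = ennreal (kapp (U \<gamma>) g y)"
    if \<gamma>: "0 < \<gamma>" and y: "y \<in> space m" and g: "g \<in> borel_measurable m" "\<And>y. y \<in> space m \<Longrightarrow> 0 \<le> g y \<and> g y \<le> C"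
    for \<gamma> y and g :: "'a \<Rightarrow> real" and C
  proof -
    interpret finite_measure "U \<gamma> y" using fin \<gamma> y by simp
    have sp: "space (U \<gamma> y) = space m" using space_kernel[OF k[OF \<gamma>] y] .
    have "integrable (U \<gamma> y) g"
      using measurable_kernel[OF k[OF \<gamma>] y g(1)] g(2)
      by (intro integrable_const_bound[where B = C] AE_I2) (auto simp: sp)
    then show ?thesis unfolding kapp_nn_def kapp_def
      using g(2) by (intro nn_integral_eq_integral AE_I2) (auto simp: sp)
  qed
  define F where "F n y = min (f y) (real n)" for n y
  have [measurable]: "F n \<in> borel_measurable m" for n unfolding F_def by measurable
  have F: "0 \<le> F n y" "F n y \<le> real n" for n y using nn by (auto simp: F_def)
  have Flim: "(\<lambda>n. ennreal (F n y)) \<longlonglongrightarrow> ennreal (f y)" for y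
  proof (rule tendsto_eventually)
    obtain N where N: "f y \<le> real N" using real_arch_simple by blast
    show "\<forall>\<^sub>F n in sequentially. ennreal (F n y) = ennreal (f y)"
      using eventually_ge_at_top[of N]
    proof eventually_elim
      case (elim n)
      then have "f y \<le> real n" using N by linarith
      then show ?case by (simp add: F_def min_absorb1)
    qed
  qed
  have Finc: "incseq (\<lambda>n. F n y)" for y by (auto simp: incseq_def F_def)
  have U_lim: "(\<lambda>n. kapp_nn (U \<gamma>) (F n) y) \<longlonglongrightarrow> kapp_nn (U \<gamma>) f y" if "0 < \<gamma>" "y \<in> space m" for \<gamma> y
    unfolding kapp_nn_def
  proof (rule nn_integral_LIMSEQ)
    show "incseq (\<lambda>n y. ennreal (F n y))"
      using Finc by (auto simp: incseq_def le_fun_def intro: ennreal_leI)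
    show "(\<lambda>y. ennreal (F n y)) \<in> borel_measurable (U \<gamma> y)" for n
      by (rule measurable_kernel[OF k[OF that(1)] that(2)]) measurable
  qed (rule Flim)
  have UU_lim: "(\<lambda>n. kapp_nn (U \<beta>) (kapp_nn (U \<alpha>) (F n)) x) \<longlonglongrightarrow> kapp_nn (U \<beta>) (kapp_nn (U \<alpha>) f) x"
  proof -
    have sp: "space (U \<beta> x) = space m" using space_kernel[OF k[OF pos(2)] x] .
    let ?G = "\<lambda>n y. kapp_nn (U \<alpha>) (F n) y"
    have mono: "?G i y \<le> ?G j y" if "i \<le> j" for i j y
      unfolding kapp_nn_def using that by (intro nn_integral_mono ennreal_leI incseqD[OF Finc])
    have "kapp_nn (U \<beta>) (kapp_nn (U \<alpha>) f) x = (\<integral>\<^sup>+y. (SUP n. ?G n y) \<partial>U \<beta> x)"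
      unfolding kapp_nn_def[of "U \<beta>"]
    proof (rule nn_integral_cong)
      fix y assume "y \<in> space (U \<beta> x)"
      then have "(\<lambda>n. ?G n y) \<longlonglongrightarrow> kapp_nn (U \<alpha>) f y" using U_lim[OF pos(1)] sp by simp
      moreover have "(\<lambda>n. ?G n y) \<longlonglongrightarrow> (SUP n. ?G n y)"
        using mono by (intro LIMSEQ_SUP) (auto simp: incseq_def)
      ultimately show "kapp_nn (U \<alpha>) f y = (SUP n. ?G n y)" by (rule LIMSEQ_unique)
    qed
    also have "\<dots> = (SUP n. kapp_nn (U \<beta>) (?G n) x)"
      unfolding kapp_nn_def[of "U \<beta>"]
    proof (rule nn_integral_monotone_convergence_SUP)
      show "incseq ?G" using mono by (auto simp: incseq_def le_fun_def)
      show "?G n \<in> borel_measurable (U \<beta> x)" for n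
        by (rule measurable_kernel[OF k[OF pos(2)] x], rule kapp_nn_measurable[OF k[OF pos(1)]]) measurable
    qed
    finally show ?thesis
      using mono by (simp only:) (intro LIMSEQ_SUP, auto simp: incseq_def kapp_nn_def[of "U \<beta>"] intro!: nn_integral_mono)
  qed
  have eq: "kapp_nn (U \<beta>) (F n) x + ennreal \<beta> * kapp_nn (U \<beta>) (kapp_nn (U \<alpha>) (F n)) x =
    kapp_nn (U \<alpha>) (F n) x + ennreal \<alpha> * kapp_nn (U \<beta>) (kapp_nn (U \<alpha>) (F n)) x" for n
  proof -
    have Fb: "F n \<in> bpB m" using F by (auto simp: bpB_def bounded_iff intro!: exI[of _ "real n"])
    define g where "g y = kapp (U \<alpha>) (F n) y" for y
    have g_nn: "kapp_nn (U \<alpha>) (F n) y = ennreal (g y)" if "y \<in> space m" for y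
      unfolding g_def using pos(1) that F by (intro bounded_kapp[where C = "real n"]) auto
    have g0: "0 \<le> g y" for y unfolding g_def kapp_def using F by (intro integral_nonneg_AE) auto
    have gm: "g \<in> borel_measurable m"
    proof -
      have "(\<lambda>y. enn2real (kapp_nn (U \<alpha>) (F n) y)) \<in> borel_measurable m"
        by (intro borel_measurable_enn2real kapp_nn_measurable k pos) measurable
      then show ?thesis by (rule measurable_cong[THEN iffD1, rotated]) (simp add: g_nn g0)
    qed
    \<comment> \<open>Boundedness of the inner image lets \<open>bounded_kapp\<close> be applied
      again, to the outer kernel.\<close>
    have g_le: "g y \<le> real n / \<alpha>" if y: "y \<in> space m" for y
    proof -
      have "ennreal (\<alpha> * g y) = ennreal \<alpha> * kapp_nn (U \<alpha>) (F n) y"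
        using pos(1) by (simp add: g_nn y ennreal_mult g0)
      also have "\<dots> \<le> ennreal \<alpha> * kapp_nn (U \<alpha>) (\<lambda>_. ennreal (real n)) y"
        unfolding kapp_nn_def using F by (intro mult_left_mono nn_integral_mono ennreal_leI) auto
      also have "\<dots> = ennreal (real n) * (ennreal \<alpha> * kapp_nn (U \<alpha>) (\<lambda>_. 1) y)"
        by (simp add: kapp_nn_def mult_ac)
      also have "\<dots> \<le> ennreal (real n) * 1"
        using U pos(1) y by (intro mult_left_mono) (auto simp: sub_markov_resolvent_def)
      finally have "\<alpha> * g y \<le> real n" by simp
      then show ?thesis using pos(1) by (simp add: field_simps)
    qed
    have a: "kapp_nn (U \<beta>) (F n) x = ennreal (kapp (U \<beta>) (F n) x)"
      using pos(2) x F by (intro bounded_kapp[where C = "real n"]) auto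
    have "kapp_nn (U \<beta>) (kapp_nn (U \<alpha>) (F n)) x = kapp_nn (U \<beta>) g x"
      unfolding kapp_nn_def[of "U \<beta>"] using space_kernel[OF k[OF pos(2)] x]
      by (intro nn_integral_cong) (simp add: g_nn)
    also have "\<dots> = ennreal (kapp (U \<beta>) g x)"
      using pos(2) x gm g0 g_le by (intro bounded_kapp[where C = "real n / \<alpha>"]) auto
    finally have c: "kapp_nn (U \<beta>) (kapp_nn (U \<alpha>) (F n)) x = ennreal (kapp (U \<beta>) g x)" .
    have nn: "0 \<le> kapp (U \<beta>) g x" "0 \<le> kapp (U \<beta>) (F n) x"
      unfolding kapp_def using F g0 by (auto intro: integral_nonneg_AE)
    \<comment> \<open>The resolvent equation with \<alpha> and \<beta> exchanged, so that
      \<open>U \<beta>\<close> acts last.\<close>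
    have "kapp (U \<beta>) (F n) x - kapp (U \<alpha>) (F n) x = (\<alpha> - \<beta>) * kapp (U \<beta>) (kapp (U \<alpha>) (F n)) x"
      using U pos Fb x by (simp add: sub_markov_resolvent_def)
    then have "kapp (U \<beta>) (F n) x + \<beta> * kapp (U \<beta>) g x = g x + \<alpha> * kapp (U \<beta>) g x"
      by (simp add: g_def[abs_def] algebra_simps)
    then have "ennreal (kapp (U \<beta>) (F n) x + \<beta> * kapp (U \<beta>) g x) = ennreal (g x + \<alpha> * kapp (U \<beta>) g x)"
      by simp
    then show ?thesis using pos nn g0 by (simp add: a c g_nn x ennreal_mult)
  qed
  have "(\<lambda>n. kapp_nn (U \<beta>) (F n) x + ennreal \<beta> * kapp_nn (U \<beta>) (kapp_nn (U \<alpha>) (F n)) x)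
      \<longlonglongrightarrow> kapp_nn (U \<beta>) f x + ennreal \<beta> * kapp_nn (U \<beta>) (kapp_nn (U \<alpha>) f) x"
    by (intro tendsto_add ennreal_tendsto_cmult U_lim UU_lim pos x) simp_all
  moreover have "(\<lambda>n. kapp_nn (U \<alpha>) (F n) x + ennreal \<alpha> * kapp_nn (U \<beta>) (kapp_nn (U \<alpha>) (F n)) x)
      \<longlonglongrightarrow> kapp_nn (U \<alpha>) f x + ennreal \<alpha> * kapp_nn (U \<beta>) (kapp_nn (U \<alpha>) f) x"
    by (intro tendsto_add ennreal_tendsto_cmult U_lim UU_lim pos x) simp_all
  ultimately show ?thesis unfolding eq by (rule LIMSEQ_unique)
qed

text \<open>For f \<ge> 0 fixed by \<alpha>U_\<alpha>, put V = U_\<beta> f and W = U_\<beta>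
  U_\<alpha> f, so that \<alpha>W = V. Cancelling V in V + \<beta>W = U_\<alpha> f + \<alpha>W
  leaves \<beta>W = U_\<alpha> f, and multiplying by \<alpha> gives \<beta>V = f. This is applied to
  the positive and negative parts of u.\<close>

lemma AE_resolvent_fixed:
  assumes U: "sub_markov_resolvent m U"
    and adj: "\<And>\<gamma>. 0 < \<gamma> \<Longrightarrow> adjoint_kernels m (U \<gamma>) (U' \<gamma>) \<gamma>"
    and u: "u \<in> Lspace m p" and p: "1 \<le> p" "p < \<infinity>" and pos: "0 < \<alpha>" "0 < \<beta>"
    and fixed: "AE x in m. u x = \<alpha> * kapp (U \<alpha>) u x"
  shows "AE x in m. u x = \<beta> * kapp (U \<beta>) u x"
proof -
  interpret A: adjoint_kernels m "U \<alpha>" "U' \<alpha>" \<alpha> by (rule adj[OF pos(1)])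
  interpret B: adjoint_kernels m "U \<beta>" "U' \<beta>" \<beta> by (rule adj[OF pos(2)])
  have part: "AE x in m. ennreal \<beta> * kapp_nn (U \<beta>) (\<lambda>y. ennreal (v y)) x = ennreal (v x)"
    if v: "v \<in> Lspace m p" and v_fixed: "AE x in m. v x = \<alpha> * kapp (U \<alpha>) v x" for v
  proof -
    have [measurable]: "v \<in> borel_measurable m" using Lspace_measurable[OF v] .
    define f where "f y = max 0 (v y)" for y
    have ef: "ennreal (f y) = ennreal (v y)" for y by (simp add: f_def ennreal_max_0_eq)
    have fm: "f \<in> borel_measurable m" and f0: "\<And>y. 0 \<le> f y" unfolding f_def by simp_all
    \<comment> \<open>The positive part of v is fixed because \<open>U \<alpha> x\<close> is carried
      by a level set of v and has full mass where v(x) \<noteq> 0.\<close>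
    have A_fixed: "AE x in m. ennreal \<alpha> * kapp_nn (U \<alpha>) f x = ennreal (f x)"
      unfolding ef
      by (rule A.AE_kernel_comp_fixed[where h = ennreal]) (use A.AE_kernel_eq_if_fixed[OF v p v_fixed] in auto)
    have "AE x in m. ennreal \<beta> * kapp_nn (U \<beta>) f x = ennreal (f x)"
      using A_fixed B.AE_kernel[OF A_fixed] B.AE_integrable_kernel[OF v p] AE_space
    proof eventually_elim
      case (elim x)
      let ?V = "kapp_nn (U \<beta>) f x" and ?W = "kapp_nn (U \<beta>) (kapp_nn (U \<alpha>) f) x"
      have "kapp_nn (U \<alpha>) f \<in> borel_measurable (U \<beta> x)"
        using fm by (intro measurable_kernel[OF B.kernel elim(4)] kapp_nn_measurable[OF A.kernel]) simp
      then have "ennreal \<alpha> * ?W = (\<integral>\<^sup>+y. ennreal \<alpha> * kapp_nn (U \<alpha>) f y \<partial>U \<beta> x)"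
        unfolding kapp_nn_def[of "U \<beta>"] by (rule nn_integral_cmult[symmetric])
      also have "\<dots> = ?V"
        unfolding kapp_nn_def[of "U \<beta>"] using elim(2) by (rule nn_integral_cong_AE)
      finally have W: "ennreal \<alpha> * ?W = ?V" .
      \<comment> \<open>Cancellation in \<open>ennreal\<close> requires V to be finite, which
        integrability of v under \<open>U \<beta> x\<close> ensures.\<close>
      have "?V < \<infinity>" using elim(3)
        by (auto simp: kapp_nn_def ef real_integrable_def less_top)
      moreover have "?V + ennreal \<beta> * ?W = kapp_nn (U \<alpha>) f x + ?V"
        using resolvent_equation_nn[OF U pos fm f0 elim(4)] W by simp
      ultimately have "ennreal \<beta> * ?W = kapp_nn (U \<alpha>) f x"
        by (auto simp: add.commute[of _ ?V] ennreal_add_left_cancel)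
      then have "ennreal \<beta> * (ennreal \<alpha> * ?W) = ennreal \<alpha> * kapp_nn (U \<alpha>) f x"
        by (metis mult.left_commute)
      then show ?case using elim(1) W by simp
    qed
    then show ?thesis by (simp add: ef)
  qed
  have "AE x in m. - u x = \<alpha> * kapp (U \<alpha>) (\<lambda>x. - u x) x"
    using fixed by eventually_elim (simp add: kapp_def)
  note minus = part[OF Lspace_uminus[OF u] this]
  show ?thesis using part[OF u fixed] minus B.AE_integrable_kernel[OF u p]
  proof eventually_elim
    case (elim x)
    have *: "\<beta> * enn2real (kapp_nn (U \<beta>) (\<lambda>y. ennreal (v y)) x) = max 0 (v x)"
      if "ennreal \<beta> * kapp_nn (U \<beta>) (\<lambda>y. ennreal (v y)) x = ennreal (v x)" for v
      using arg_cong[OF that, of enn2real] pos(2)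
      by (simp add: enn2real_mult max_def enn2real_ennreal ennreal_neg)
    have "\<beta> * kapp (U \<beta>) u x = max 0 (u x) - max 0 (- u x)"
      using *[OF elim(1)] *[OF elim(2)] elim(3)
      by (simp add: kapp_def kapp_nn_def real_lebesgue_integral_def right_diff_distrib)
    then show ?case by simp
  qed
qed

section \<open>Kernels of the generators\<close>

text \<open>If u = U_\<alpha> f and \<alpha>U_\<alpha> f - f = 0 a.e., then f = \<alpha>u a.e., and
  \<open>AE_kernel\<close> allows substituting this under the kernel; conversely f = \<alpha>u is
  the witness. The exponent enters only through \<open>Lspace\<close>, which covers q = \<infinity>
  in (ii).\<close>

lemma gen_ker_iff:
  assumes adj: "\<And>\<gamma>. 0 < \<gamma> \<Longrightarrow> adjoint_kernels m (U \<gamma>) (U' \<gamma>) \<gamma>"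
  shows "u \<in> gen_ker m U q \<longleftrightarrow>
    u \<in> Lspace m q \<and> (\<exists>\<alpha>>0. AE x in m. u x = \<alpha> * kapp (U \<alpha>) u x)"
proof
  assume "u \<in> gen_ker m U q"
  then obtain \<alpha> f where \<alpha>: "0 < \<alpha>" and u: "u \<in> Lspace m q" and f: "f \<in> Lspace m q"
    and uf: "AE x in m. u x = kapp (U \<alpha>) f x" and "AE x in m. 0 = \<alpha> * kapp (U \<alpha>) f x - f x"
    by (auto simp: gen_ker_def generator_def)
  interpret adjoint_kernels m "U \<alpha>" "U' \<alpha>" \<alpha> by (rule adj[OF \<alpha>])
  have "AE x in m. f x = \<alpha> * u x" using uf \<open>AE x in m. 0 = _\<close> by eventually_elim simp
  from AE_kernel[OF this] have "AE x in m. u x = \<alpha> * kapp (U \<alpha>) u x"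
    using uf AE_space
  proof eventually_elim
    case (elim x)
    have [measurable]: "u \<in> borel_measurable (U \<alpha> x)" "f \<in> borel_measurable (U \<alpha> x)"
      using measurable_kernel[OF kernel elim(3)] Lspace_measurable u f by blast+
    have "kapp (U \<alpha>) f x = (\<integral>y. \<alpha> * u y \<partial>U \<alpha> x)"
      unfolding kapp_def using elim(1) by (intro integral_cong_AE) measurable
    then show ?case using elim(2) by (simp add: kapp_def)
  qed
  then show "u \<in> Lspace m q \<and> (\<exists>\<alpha>>0. AE x in m. u x = \<alpha> * kapp (U \<alpha>) u x)"
    using u \<alpha> by blast
next
  assume "u \<in> Lspace m q \<and> (\<exists>\<alpha>>0. AE x in m. u x = \<alpha> * kapp (U \<alpha>) u x)"
  then obtain \<alpha> where u: "u \<in> Lspace m q" and \<alpha>: "0 < \<alpha>"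
    and fixed: "AE x in m. u x = \<alpha> * kapp (U \<alpha>) u x" by blast
  have "(\<lambda>x. \<alpha> * u x) \<in> Lspace m q" by (rule Lspace_cmult[OF u])
  moreover have "AE x in m. u x = kapp (U \<alpha>) (\<lambda>x. \<alpha> * u x) x"
    using fixed by eventually_elim (simp add: kapp_def)
  moreover have "AE x in m. 0 = \<alpha> * kapp (U \<alpha>) (\<lambda>x. \<alpha> * u x) x - \<alpha> * u x"
    using fixed by eventually_elim (simp add: kapp_def)
  ultimately show "u \<in> gen_ker m U q"
    unfolding gen_ker_def generator_def using u \<alpha> Lspace_zero[of m q] by blast
qed

section \<open>The four assertions on generators and invariant functions\<close>

theorem corollary3p3:
  fixes m :: "'a measure" and U Ustar :: "real \<Rightarrow> 'a \<Rightarrow> 'a measure" and p p' :: ennreal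
  assumes "lusin m"
    and "sub_markov_resolvent m U"
    and "\<And>\<beta>. \<beta> > 0 \<Longrightarrow> min_stable (excessive m U \<beta>)"
    and "\<And>\<beta> c. \<beta> > 0 \<Longrightarrow> c \<ge> 0 \<Longrightarrow> (\<lambda>_. ennreal c) \<in> excessive m U \<beta>"
    and "\<And>\<beta>. \<beta> > 0 \<Longrightarrow> generates m (excessive m U \<beta>)"
    and "sigma_finite_measure m"
    and "sub_invariant m U"
    and "adjoint_resolvent m U Ustar"
    and "1 \<le> p" and "p < \<infinity>" and "1 / p + 1 / p' = 1"
  shows "gen_ker m U p = gen_ker m Ustar p \<and>
    gen_ker m U p \<inter> Lspace m p' \<subseteq> gen_ker m Ustar p' \<and>
    (\<forall>u \<in> gen_ker m U p. resolvent_invariant m U u) \<and>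
    ((\<forall>\<alpha>>0. AE x in m. \<alpha> * kapp (U \<alpha>) (\<lambda>_. 1) x = 1) \<or>
     (\<forall>\<alpha>>0. AE x in m. \<alpha> * kapp (Ustar \<alpha>) (\<lambda>_. 1) x = 1) \<longrightarrow>
     (\<forall>u \<in> Lspace m p. resolvent_invariant m U u \<longrightarrow> u \<in> gen_ker m U p))"
proof -
  note p = assms(9,10)
  have U': "sub_markov_resolvent m Ustar" using assms(8) by (simp add: adjoint_resolvent_def)
  have adj: "adjoint_kernels m (U \<gamma>) (Ustar \<gamma>) \<gamma>" if "0 < \<gamma>" for \<gamma>
    using that assms(2,8) U' by (simp add: adjoint_kernels_def adjoint_resolvent_def sub_markov_resolvent_def)
  have adj': "adjoint_kernels m (Ustar \<gamma>) (U \<gamma>) \<gamma>" if "0 < \<gamma>" for \<gamma>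
    by (rule adjoint_kernels_swap[OF adj[OF that]])
  note ker = gen_ker_iff[where U = U and U' = Ustar, OF adj]
  note ker' = gen_ker_iff[where U = Ustar and U' = U, OF adj']
  \<comment> \<open>Both directions hold at the same \<gamma>, since the two kernels play symmetric
    roles.\<close>
  have fixed_iff: "(AE x in m. u x = \<gamma> * kapp (U \<gamma>) u x) \<longleftrightarrow> (AE x in m. u x = \<gamma> * kapp (Ustar \<gamma>) u x)"
    if "u \<in> Lspace m p" "0 < \<gamma>" for u \<gamma>
    using adjoint_kernels.AE_adjoint_kernel_fixed[OF adj that(1) p]
      adjoint_kernels.AE_adjoint_kernel_fixed[OF adj' that(1) p] that(2) by blast
  have i: "gen_ker m U p = gen_ker m Ustar p"
    using fixed_iff by (auto simp: set_eq_iff ker ker')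
  \<comment> \<open>By (i) the fixed-point equation for \<open>Ustar\<close> is known, and it does
    not mention the exponent.\<close>
  have ii: "gen_ker m U p \<inter> Lspace m p' \<subseteq> gen_ker m Ustar p'"
    unfolding i by (auto simp: ker')
  have iii: "resolvent_invariant m U u" if "u \<in> gen_ker m U p" for u
  proof -
    obtain \<alpha> where u: "u \<in> Lspace m p" and \<alpha>: "0 < \<alpha>" "AE x in m. u x = \<alpha> * kapp (U \<alpha>) u x"
      using \<open>u \<in> gen_ker m U p\<close> by (auto simp: ker)
    have "AE x in m. kapp (U \<beta>) (\<lambda>y. u y * f y) x = u x * kapp (U \<beta>) f x"
      if \<beta>: "0 < \<beta>" and f: "f \<in> bpB m" for \<beta> f
    proof -
      interpret adjoint_kernels m "U \<beta>" "Ustar \<beta>" \<beta> by (rule adj[OF \<beta>])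
      \<comment> \<open>The kernel of the generator provides one parameter \<alpha>, whereas
        invariance concerns every \<beta>.\<close>
      have "AE x in m. u x = \<beta> * kapp (U \<beta>) u x"
        by (rule AE_resolvent_fixed[OF assms(2) adj u p \<alpha>(1) \<beta> \<alpha>(2)])
      then have "AE x in m. AE y in U \<beta> x. u y = u x"
        using AE_kernel_eq_if_fixed[OF u p] by auto
      then show ?thesis
        using Lspace_measurable[OF u] f by (intro AE_kernel_mult) (auto simp: bpB_def)
    qed
    then show ?thesis using u p(1) by (auto simp: resolvent_invariant_def)
  qed
  have iv: "u \<in> gen_ker m U p"
    if one: "(\<forall>\<alpha>>0. AE x in m. \<alpha> * kapp (U \<alpha>) (\<lambda>_. 1) x = 1) \<or>
        (\<forall>\<alpha>>0. AE x in m. \<alpha> * kapp (Ustar \<alpha>) (\<lambda>_. 1) x = 1)"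
      and u: "u \<in> Lspace m p" and inv: "resolvent_invariant m U u" for u
  proof -
    \<comment> \<open>The choice 1 is arbitrary: \<open>gen_ker_iff\<close> asks for a single
      parameter.\<close>
    interpret A: adjoint_kernels m "U 1" "Ustar 1" 1 by (rule adj) simp
    interpret B: adjoint_kernels m "Ustar 1" "U 1" 1 by (rule adj') simp
    have um: "u \<in> borel_measurable m" using Lspace_measurable[OF u] .
    have eq: "AE x in m. AE y in U 1 x. u y = u x"
      using inv by (intro A.AE_kernel_eq_if_invariant[OF u p]) (simp add: resolvent_invariant_def)
    have "AE x in m. u x \<noteq> 0 \<longrightarrow> 1 * kapp (U 1) (\<lambda>_. 1) x = 1"
      using one
    proof
      assume "\<forall>\<alpha>>0. AE x in m. \<alpha> * kapp (U \<alpha>) (\<lambda>_. 1) x = 1"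
      then have "AE x in m. 1 * kapp (U 1) (\<lambda>_. 1) x = 1" by (metis zero_less_one)
      then show ?thesis by eventually_elim simp
    next
      \<comment> \<open>The level set property passes to \<open>Ustar 1\<close>, and from there the
        unit mass returns to \<open>U 1\<close> on {u \<noteq> 0}.\<close>
      assume "\<forall>\<alpha>>0. AE x in m. \<alpha> * kapp (Ustar \<alpha>) (\<lambda>_. 1) x = 1"
      then have "AE x in m. 1 * kapp (Ustar 1) (\<lambda>_. 1) x = 1" by (metis zero_less_one)
      then have "AE x in m. u x \<noteq> 0 \<longrightarrow> 1 * kapp (Ustar 1) (\<lambda>_. 1) x = 1" by eventually_elim simp
      then show ?thesis
        by (rule B.AE_adjoint_mass_one[OF u p A.AE_adjoint_kernel_eq[OF um eq]])
    qed
    then have "AE x in m. u x = 1 * kapp (U 1) u x"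
      by (rule A.AE_kernel_fixed_if_eq[OF um eq])
    then show ?thesis using u by (auto simp: ker intro!: exI[of _ "1::real"])
  qed
  show ?thesis using i ii iii iv by blast
qed

end
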